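(* Let $a,b,J$ be positive integers with $J\ge 3$. Then: (1) if $a\ge b$, then $H(a+b,J) \leq H(a,J)+H(b,J-1)+b$; in particular, if $a\ge 2$, then $H(2a-1,J) \leq H(a,J)+H(a-1,J-1)+a-1$; (2) $H(2a,J) \leq 2H(a,J-1)+2a$.
   Context: A Golomb ruler is a set $\{a_1,\dots,a_k\}$ of $k$ distinct non-negative integers such that all the differences $a_i-a_j$, $i\neq j$, are distinct. An $(I,J,n)$-DGR is a set of $I$ pairwise disjoint Golomb rulers, each being a $J$-element subset of $\{1,2,\dots,n\}$. For positive integers $I,J$, $H(I,J)$ is the least positive integer $n$ such that there is an $(I,J,n)$-DGR. *)

theory Defs
  imports Main
begin

text \<open>Differences are taken in the integers, over ordered pairs of distinct marks.\<close>

definition golomb_ruler :: "nat set \<Rightarrow> bool" where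
  "golomb_ruler S \<longleftrightarrow>
     finite S \<and> inj_on (\<lambda>(x, y). int x - int y) {(x, y). x \<in> S \<and> y \<in> S \<and> x \<noteq> y}"

definition is_DGR :: "nat \<Rightarrow> nat \<Rightarrow> nat \<Rightarrow> nat set set \<Rightarrow> bool" where
  "is_DGR I J n D \<longleftrightarrow>
     finite D \<and> card D = I \<and> pairwise disjnt D \<and>
     (\<forall>S\<in>D. golomb_ruler S \<and> S \<subseteq> {1..n} \<and> card S = J)"

definition H :: "nat \<Rightarrow> nat \<Rightarrow> nat" where
  "H I J = (LEAST n. 0 < n \<and> (\<exists>D. is_DGR I J n D))"

text \<open>The minimum in the definition of \<^const>\<open>H\<close> is over a nonempty set: group powers of three.\<close>

lemma pow3_sum_eq:
  fixes a b c d :: nat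
  assumes "(3::nat) ^ a + 3 ^ d = 3 ^ c + 3 ^ b" "a \<noteq> b"
  shows "a = c \<and> b = d"
  using assms
proof (induction a arbitrary: b c d)
  case 0
  have inj: "(3::nat) ^ k = 3 ^ l \<longleftrightarrow> k = l" for k l by simp
  have m: "k = 0 \<or> (\<exists>q. (3::nat) ^ k = 3 * q)" for k by (cases k) auto
  have "c = 0"
  proof (rule ccontr)
    assume "c \<noteq> 0"
    then obtain p q where "(3::nat) ^ c = 3 * p" "(3::nat) ^ b = 3 * q"
      using m 0 by metis
    moreover obtain r where "d = 0 \<or> (3::nat) ^ d = 3 * r" using m by blast
    ultimately show False using 0(1) by (auto, presburger+)
  qed
  with 0 show ?case by simp
next
  case (Suc a)
  have m: "k = 0 \<or> (\<exists>q. (3::nat) ^ k = 3 * q)" for k by (cases k) auto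
  obtain p q r where pqr: "b = 0 \<or> (3::nat) ^ b = 3 * p" "c = 0 \<or> (3::nat) ^ c = 3 * q"
      "d = 0 \<or> (3::nat) ^ d = 3 * r"
    using m by metis
  define s where "s = (3::nat) ^ a"
  have eq: "3 * s + 3 ^ d = 3 ^ c + 3 ^ b" using Suc.prems by (simp add: s_def)
  consider "d = 0" "b = 0" | "d = 0" "c = 0" | "d \<noteq> 0" "c \<noteq> 0" "b \<noteq> 0"
    using pqr eq by (cases "b = 0"; cases "c = 0"; cases "d = 0"; simp; presburger)
  then show ?case
  proof cases
    case 1
    then have "(3::nat) ^ Suc a = 3 ^ c" using Suc.prems by simp
    then show ?thesis using 1 by (simp del: power_Suc)
  next
    case 2
    then have "(3::nat) ^ Suc a = 3 ^ b" using Suc.prems by simp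
    then show ?thesis using Suc.prems by (simp del: power_Suc)
  next
    case 3
    then obtain b' c' d' where "b = Suc b'" "c = Suc c'" "d = Suc d'"
      by (metis not0_implies_Suc)
    then show ?thesis using Suc.IH[of d' c' b'] Suc.prems by simp
  qed
qed

lemma golomb_ruler_pow3:
  assumes "finite E"
  shows "golomb_ruler ((\<lambda>k. 3 ^ k) ` E)"
proof -
  have "x = x' \<and> y = y'"
    if "int (3 ^ x) - int (3 ^ y) = int (3 ^ x') - int (3 ^ y')" "x \<noteq> y" for x y x' y' :: nat
  proof -
    have "int (3 ^ x + 3 ^ y') = int (3 ^ x' + 3 ^ y)"
      using that by simp
    then have "(3::nat) ^ x + 3 ^ y' = 3 ^ x' + 3 ^ y"
      by (simp only: of_nat_eq_iff)
    with that(2) show ?thesis using pow3_sum_eq by blast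
  qed
  then show ?thesis
    using assms by (fastforce simp: golomb_ruler_def inj_on_def)
qed

lemma DGR_exists:
  assumes "0 < J"
  shows "\<exists>n>0. \<exists>D. is_DGR I J n D"
proof -
  define R where "R i = (\<lambda>k. (3::nat) ^ k) ` {i * J..<i * J + J}" for i
  have dj: "disjnt (R i) (R i')" if "i \<noteq> i'" for i i'
  proof -
    have "k div J = i" if "k \<in> {i * J..<i * J + J}" for k i
      using that assms by (intro div_nat_eqI) (auto simp: algebra_simps)
    with \<open>i \<noteq> i'\<close> have "{i * J..<i * J + J} \<inter> {i' * J..<i' * J + J} = {}" by blast
    then show ?thesis unfolding R_def disjnt_def by auto
  qed
  have cR: "card (R i) = J" for i
    unfolding R_def by (subst card_image) (auto simp: inj_on_def)
  have "R i \<noteq> R i'" if "i \<noteq> i'" for i i'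
    using dj[OF that] cR[of i] assms by (metis card.empty disjnt_self_iff_empty less_irrefl)
  then have "inj_on R {..<I}" by (meson inj_onI)
  then have "card (R ` {..<I}) = I" by (simp add: card_image)
  moreover have "R i \<subseteq> {1..3 ^ (I * J)}" if "i < I" for i
  proof -
    have "i * J + J \<le> I * J"
      using that by (metis Suc_leI add.commute mult_Suc mult_le_mono1)
    then show ?thesis unfolding R_def by auto
  qed
  moreover have "golomb_ruler (R i)" for i
    unfolding R_def by (rule golomb_ruler_pow3) simp
  moreover have "pairwise disjnt (R ` {..<I})"
    using dj unfolding pairwise_def by (metis imageE)
  ultimately have "is_DGR I J (3 ^ (I * J)) (R ` {..<I})"
    using cR unfolding is_DGR_def by auto
  then show ?thesis by (metis zero_less_numeral zero_less_power)
qed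

end

theory Submission
  imports Defs
begin

text \<open>A ruler contained in an interval of length \<open>n\<close> stays Golomb when one mark at distance at
  least \<open>n\<close> from the interval is added, so suitable rulers can be lengthened by one mark each at
  the cost of one extra position per ruler. For (1), the marks are laid out as: the rulers with
  \<open>J - 1\<close> marks, the rulers with \<open>J\<close> marks, the \<open>b\<close> extra marks; the middle block is long enough
  because \<open>H b (J - 1) \<le> H a J\<close> when \<open>b \<le> a\<close>. For (2), two copies of an optimal family with
  \<open>J - 1\<close> marks are put side by side, with \<open>a\<close> extra marks on either side; each copy
  receives the extra marks lying beyond the other copy.\<close>

text \<open>The interval \<open>{1..n}\<close> of \<open>is_DGR\<close> is replaced by an arbitrary
  set \<open>X\<close>, because rulers that have received an extra mark live in a union of two
  separated intervals.\<close>

definition dgr_in :: "nat \<Rightarrow> nat \<Rightarrow> nat set \<Rightarrow> nat set set \<Rightarrow> bool" where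
  "dgr_in I J X D \<longleftrightarrow>
     finite D \<and> card D = I \<and> pairwise disjnt D \<and>
     (\<forall>S\<in>D. golomb_ruler S \<and> S \<subseteq> X \<and> card S = J)"

lemma is_DGR_iff_dgr_in: "is_DGR I J n D \<longleftrightarrow> dgr_in I J {1..n} D"
  by (simp add: is_DGR_def dgr_in_def)

section \<open>Single Golomb rulers: subsets, translates, adding a mark\<close>

lemma golomb_ruler_iff:
  "golomb_ruler S \<longleftrightarrow> finite S \<and>
     (\<forall>x\<in>S. \<forall>y\<in>S. \<forall>x'\<in>S. \<forall>y'\<in>S.
        x \<noteq> y \<longrightarrow> int x - int y = int x' - int y' \<longrightarrow> x = x' \<and> y = y')"
proof -
  \<comment> \<open>A difference equal to a nonzero one is nonzero, so it suffices to require
    \<open>x \<noteq> y\<close> for one of the two pairs.\<close>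
  have "x' \<noteq> y'" if "x \<noteq> y" "int x - int y = int x' - int y'" for x y x' y' :: nat
    using that by linarith
  then show ?thesis
    unfolding golomb_ruler_def inj_on_def Ball_def mem_Collect_eq split_paired_All prod.case
      prod.inject by blast
qed

lemma golomb_rulerI:
  assumes "finite S"
    and "\<And>x y x' y'. x \<in> S \<Longrightarrow> y \<in> S \<Longrightarrow> x' \<in> S \<Longrightarrow> y' \<in> S \<Longrightarrow> x \<noteq> y \<Longrightarrow>
      int x - int y = int x' - int y' \<Longrightarrow> x = x' \<and> y = y'"
  shows "golomb_ruler S"
  using assms unfolding golomb_ruler_iff by blast

lemma golomb_rulerD:
  assumes "golomb_ruler S" "x \<in> S" "y \<in> S" "x' \<in> S" "y' \<in> S" "x \<noteq> y"
    "int x - int y = int x' - int y'"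
  shows "x = x' \<and> y = y'"
  using assms unfolding golomb_ruler_iff by blast

lemma golomb_ruler_finite: "golomb_ruler S \<Longrightarrow> finite S"
  by (simp add: golomb_ruler_def)

lemma golomb_ruler_subset:
  assumes "golomb_ruler S" "T \<subseteq> S"
  shows "golomb_ruler T"
proof (rule golomb_rulerI)
  show "finite T"
    using assms golomb_ruler_finite finite_subset by blast
qed (use assms(2) in \<open>blast dest: golomb_rulerD[OF assms(1)]\<close>)

lemma golomb_ruler_shift:
  assumes "golomb_ruler S"
  shows "golomb_ruler ((+) k ` S)"
proof (rule golomb_rulerI)
  show "finite ((+) k ` S)"
    using golomb_ruler_finite[OF assms] by simp
  fix x y x' y'
  assume "x \<in> (+) k ` S" "y \<in> (+) k ` S" "x' \<in> (+) k ` S" "y' \<in> (+) k ` S"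
    and ne: "x \<noteq> y" and eq: "int x - int y = int x' - int y'"
  then obtain u v u' v' where uv: "u \<in> S" "v \<in> S" "u' \<in> S" "v' \<in> S"
      "x = k + u" "y = k + v" "x' = k + u'" "y' = k + v'"
    by blast
  then show "x = x' \<and> y = y'"
    using golomb_rulerD[OF assms uv(1-4)] ne eq by simp
qed

text \<open>A difference involving \<open>x\<close> is larger in absolute value than every
  difference inside \<open>S\<close>, so the two kinds never coincide. Two differences that both
  involve \<open>x\<close> either cancel or make \<open>x\<close> a midpoint of marks of
  \<open>S\<close>.\<close>

lemma golomb_ruler_insert:
  assumes S: "golomb_ruler S"
    and far: "\<And>s s' t. s \<in> S \<Longrightarrow> s' \<in> S \<Longrightarrow> t \<in> S \<Longrightarrow> \<bar>int s - int s'\<bar> < \<bar>int x - int t\<bar>"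
  shows "golomb_ruler (insert x S)"
proof (rule golomb_rulerI)
  show "finite (insert x S)"
    using golomb_ruler_finite[OF S] by simp
  fix u v u' v'
  assume mem: "u \<in> insert x S" "v \<in> insert x S" "u' \<in> insert x S" "v' \<in> insert x S"
    and ne: "u \<noteq> v" and eq: "int u - int v = int u' - int v'"
  have ne': "u' \<noteq> v'"
    using ne eq by linarith
  \<comment> \<open>If \<open>x\<close> were midway between \<open>s\<close> and \<open>s'\<close>,
    their distance would be twice that from \<open>x\<close> to \<open>s\<close>, against
    \<open>far\<close>.\<close>
  have mid: False if "s \<in> S" "s' \<in> S" "int s - int x = int x - int s'" for s s'
    using far[OF that(1,2,1)] that(3) by linarith
  \<comment> \<open>Each pair is not \<open>(x, x)\<close>, which leaves three patterns for each and
    nine in all.\<close>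
  consider "u \<in> S" "v \<in> S" "u' \<in> S" "v' \<in> S"
    | "u = x" "u' = x" | "v = x" "v' = x"
    | "u = x" "v \<in> S" "u' \<in> S" "v' = x" | "u \<in> S" "v = x" "u' = x" "v' \<in> S"
    | "u = x" "v \<in> S" "u' \<in> S" "v' \<in> S" | "u \<in> S" "v = x" "u' \<in> S" "v' \<in> S"
    | "u \<in> S" "v \<in> S" "u' = x" "v' \<in> S" | "u \<in> S" "v \<in> S" "u' \<in> S" "v' = x"
    using mem ne ne' unfolding insert_iff by argo
  then show "u = u' \<and> v = v'"
  proof cases
    case 1
    show ?thesis by (rule golomb_rulerD[OF S 1 ne eq])
  next
    case 2
    then show ?thesis using eq by simp
  next
    case 3
    then show ?thesis using eq by simp
  next
    case 4
    then show ?thesis using eq mid[of u' v] by simp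
  next
    case 5
    then show ?thesis using eq mid[of u v'] by simp
  next
    case 6
    then show ?thesis using eq far[OF 6(3,4,2)] by linarith
  next
    case 7
    then show ?thesis using eq far[OF 7(3,4,1)] by linarith
  next
    case 8
    then show ?thesis using eq far[OF 8(1,2,4)] by linarith
  next
    case 9
    then show ?thesis using eq far[OF 9(1,2,3)] by linarith
  qed
qed

section \<open>Families of disjoint rulers and operations on them\<close>

lemma dgr_inI:
  assumes "finite D" "card D = I"
    and "\<And>S T. S \<in> D \<Longrightarrow> T \<in> D \<Longrightarrow> S \<noteq> T \<Longrightarrow> disjnt S T"
    and "\<And>S. S \<in> D \<Longrightarrow> golomb_ruler S" "\<And>S. S \<in> D \<Longrightarrow> S \<subseteq> X" "\<And>S. S \<in> D \<Longrightarrow> card S = J"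
  shows "dgr_in I J X D"
  using assms by (simp add: dgr_in_def pairwise_def)

lemma dgr_inD:
  assumes "dgr_in I J X D"
  shows "finite D" "card D = I"
    and "S \<in> D \<Longrightarrow> T \<in> D \<Longrightarrow> S \<noteq> T \<Longrightarrow> disjnt S T"
    and "S \<in> D \<Longrightarrow> golomb_ruler S" "S \<in> D \<Longrightarrow> S \<subseteq> X" "S \<in> D \<Longrightarrow> card S = J"
  using assms by (auto simp: dgr_in_def pairwise_def)

lemma dgr_in_mono: "dgr_in I J X D \<Longrightarrow> X \<subseteq> Y \<Longrightarrow> dgr_in I J Y D"
  unfolding dgr_in_def by blast

text \<open>Common scheme for translating, lengthening and shortening all rulers of a family at
  once.\<close>

lemma dgr_in_map:
  assumes D: "dgr_in I J X D" and inj: "inj_on f D"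
    and dj: "\<And>S T. S \<in> D \<Longrightarrow> T \<in> D \<Longrightarrow> disjnt S T \<Longrightarrow> S \<noteq> T \<Longrightarrow> disjnt (f S) (f T)"
    and f: "\<And>S. S \<in> D \<Longrightarrow> golomb_ruler (f S)" "\<And>S. S \<in> D \<Longrightarrow> f S \<subseteq> Y"
      "\<And>S. S \<in> D \<Longrightarrow> card (f S) = J'"
  shows "dgr_in I J' Y (f ` D)"
proof (rule dgr_inI)
  show "finite (f ` D)" "card (f ` D) = I"
    using dgr_inD(1,2)[OF D] inj by (simp_all add: card_image)
  show "disjnt S' T'" if S': "S' \<in> f ` D" and T': "T' \<in> f ` D" and ne: "S' \<noteq> T'" for S' T'
  proof -
    obtain S T where ST: "S \<in> D" "T \<in> D" "S' = f S" "T' = f T"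
      using S' T' by (elim imageE)
    with ne have "S \<noteq> T" by auto
    then show ?thesis
      unfolding ST(3,4) by (intro dj dgr_inD(3)[OF D] ST(1,2))
  qed
qed (use f in \<open>elim imageE; simp\<close>)+

lemma dgr_in_shift:
  assumes "dgr_in I J {l..u} D"
  shows "dgr_in I J {k + l..k + u} ((`) ((+) k) ` D)"
proof (rule dgr_in_map[OF assms])
  show "inj_on ((`) ((+) k)) D"
    by (simp add: inj_on_def inj_image_eq_iff)
  show "disjnt ((+) k ` S) ((+) k ` T)" if "disjnt S T" for S T
    using that unfolding disjnt_def by auto
  fix S assume S: "S \<in> D"
  show "golomb_ruler ((+) k ` S)"
    using dgr_inD(4)[OF assms S] by (rule golomb_ruler_shift)
  show "(+) k ` S \<subseteq> {k + l..k + u}"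
    using dgr_inD(5)[OF assms S] by auto
  show "card ((+) k ` S) = J"
    using dgr_inD(6)[OF assms S] by (simp add: card_image)
qed

text \<open>With \<open>0 < J\<close> the empty ruler is excluded; it is the only set that could lie
  in both families, so the cardinalities add.\<close>

lemma dgr_in_Un:
  assumes D: "dgr_in I J X D" and E: "dgr_in I' J Y E"
    and dj: "X \<inter> Y = {}" and J: "0 < J"
  shows "dgr_in (I + I') J (X \<union> Y) (D \<union> E)"
proof (rule dgr_inI)
  have cross: "disjnt S T" if "S \<in> D" "T \<in> E" for S T
    using dgr_inD(5)[OF D that(1)] dgr_inD(5)[OF E that(2)] dj unfolding disjnt_def by blast
  have "S \<noteq> {}" if "S \<in> D" for S
    using dgr_inD(6)[OF D that] J by auto
  \<comment> \<open>A common member would be disjoint from itself by \<open>cross\<close>, hence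
    empty.\<close>
  then have "S \<notin> E" if "S \<in> D" for S
    using cross[OF that, of S] that by auto
  then have "D \<inter> E = {}"
    by blast
  then show "card (D \<union> E) = I + I'"
    using dgr_inD(1,2)[OF D] dgr_inD(1,2)[OF E] by (simp add: card_Un_disjoint)
  show "finite (D \<union> E)"
    using dgr_inD(1)[OF D] dgr_inD(1)[OF E] by simp
  show "disjnt S T" if "S \<in> D \<union> E" "T \<in> D \<union> E" "S \<noteq> T" for S T
    using that(1,2)
  proof (elim UnE)
    show ?thesis if "S \<in> D" "T \<in> D"
      using dgr_inD(3)[OF D that \<open>S \<noteq> T\<close>] .
    show ?thesis if "S \<in> E" "T \<in> E"
      using dgr_inD(3)[OF E that \<open>S \<noteq> T\<close>] .
    show ?thesis if "S \<in> D" "T \<in> E"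
      using cross[OF that] .
    show ?thesis if "S \<in> E" "T \<in> D"
      using cross[OF that(2,1)] by (rule disjnt_sym)
  qed
  show "golomb_ruler S" "card S = J" if "S \<in> D \<union> E" for S
    using that dgr_inD(4,6)[OF D] dgr_inD(4,6)[OF E] by auto
  show "S \<subseteq> X \<union> Y" if "S \<in> D \<union> E" for S
    using that dgr_inD(5)[OF D, of S] dgr_inD(5)[OF E, of S] by blast
qed

text \<open>A bijection from \<open>D\<close> to \<open>E\<close> hands each ruler its own extra
  mark, which keeps the rulers disjoint; the distance condition is what
  \<open>golomb_ruler_insert\<close> asks for.\<close>

lemma dgr_in_extend:
  assumes D: "dgr_in I J X D" and E: "finite E" "card E = I"
    and far: "\<And>s s' t x. s \<in> X \<Longrightarrow> s' \<in> X \<Longrightarrow> t \<in> X \<Longrightarrow> x \<in> E \<Longrightarrow>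
      \<bar>int s - int s'\<bar> < \<bar>int x - int t\<bar>"
  obtains D' where "dgr_in I (Suc J) (X \<union> E) D'"
proof -
  obtain f where f: "bij_betw f D E"
    using finite_same_card_bij[OF dgr_inD(1)[OF D] E(1)] dgr_inD(2)[OF D] E(2) by auto
  \<comment> \<open>With all four points equal, \<open>far\<close> would read
    \<open>0 < 0\<close>.\<close>
  have disj: "x \<notin> X" if "x \<in> E" for x
    using far[of x x x x] that by auto
  have fE: "f S \<in> E" if "S \<in> D" for S
    using f that by (rule bij_betw_apply)
  have fX: "f S \<notin> X" if "S \<in> D" for S
    by (intro disj fE that)
  note sub = dgr_inD(5)[OF D]
  have f_ne: "f S \<noteq> f T" if "S \<in> D" "T \<in> D" "S \<noteq> T" for S T
    using f that inj_onD[of f D S T] by (auto simp: bij_betw_def)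
  have "dgr_in I (Suc J) (X \<union> E) ((\<lambda>S. insert (f S) S) ` D)"
  proof (rule dgr_in_map[OF D])
    show "inj_on (\<lambda>S. insert (f S) S) D"
    proof (rule inj_onI, rule ccontr)
      fix S T assume ST: "S \<in> D" "T \<in> D" "insert (f S) S = insert (f T) T" "S \<noteq> T"
      then have "f S \<in> T"
        using f_ne[OF ST(1,2,4)] by blast
      then show False
        using fX[OF ST(1)] sub[OF ST(2)] by blast
    qed
    show "disjnt (insert (f S) S) (insert (f T) T)"
      if ST: "S \<in> D" "T \<in> D" "disjnt S T" "S \<noteq> T" for S T
    proof -
      have "f S \<notin> T" "f T \<notin> S"
        using fX[OF ST(1)] fX[OF ST(2)] sub[OF ST(1)] sub[OF ST(2)] by blast+
      then show ?thesis
        using f_ne[OF ST(1,2,4)] ST(3) by simp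
    qed
    fix S assume S: "S \<in> D"
    show "golomb_ruler (insert (f S) S)"
    proof (rule golomb_ruler_insert[OF dgr_inD(4)[OF D S]])
      show "\<bar>int s - int s'\<bar> < \<bar>int (f S) - int t\<bar>" if "s \<in> S" "s' \<in> S" "t \<in> S" for s s' t
        by (intro far fE[OF S] that[THEN subsetD[OF sub[OF S]]])
    qed
    show "insert (f S) S \<subseteq> X \<union> E"
      using fE[OF S] sub[OF S] by blast
    have "f S \<notin> S"
      using fX[OF S] sub[OF S] by blast
    then show "card (insert (f S) S) = Suc J"
      using golomb_ruler_finite[OF dgr_inD(4)[OF D S]] dgr_inD(6)[OF D S] by simp
  qed
  then show ?thesis by (rule that)
qed

text \<open>Surplus rulers are discarded first, then surplus marks of each remaining ruler. This
  yields the monotonicity of \<open>H\<close>.\<close>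

lemma dgr_in_restrict:
  assumes D: "dgr_in I J X D" and I': "I' \<le> I" and J': "0 < J'" "J' \<le> J"
  obtains D' where "dgr_in I' J' X D'"
proof -
  have "I' \<le> card D"
    using dgr_inD(2)[OF D] I' by simp
  then obtain C where C: "C \<subseteq> D" "card C = I'"
    by (rule obtain_subset_with_card_n)
  have CD: "dgr_in I' J X C"
    using finite_subset[OF C(1) dgr_inD(1)[OF D]] C(2)
  proof (rule dgr_inI)
  qed (use C(1) in \<open>meson dgr_inD[OF D] subsetD\<close>)+
  have "\<exists>T. T \<subseteq> S \<and> card T = J'" if "S \<in> C" for S
    using obtain_subset_with_card_n[of J' S] dgr_inD(6)[OF CD that] J' by auto
  then have "\<forall>S\<in>C. \<exists>T. T \<subseteq> S \<and> card T = J'"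
    by blast
  then obtain g where "\<forall>S\<in>C. g S \<subseteq> S \<and> card (g S) = J'"
    by (rule bchoice[THEN exE])
  then have g: "g S \<subseteq> S" "card (g S) = J'" if "S \<in> C" for S
    using that by auto
  \<comment> \<open>Nonemptiness makes \<open>g\<close> injective: disjoint rulers cannot share a
    nonempty subset.\<close>
  have ne: "g S \<noteq> {}" if "S \<in> C" for S
    using g(2)[OF that] J'(1) by auto
  have "dgr_in I' J' X (g ` C)"
  proof (rule dgr_in_map[OF CD])
    show "inj_on g C"
    proof (rule inj_onI, rule ccontr)
      fix S T assume ST: "S \<in> C" "T \<in> C" "g S = g T" "S \<noteq> T"
      then have "disjnt S T"
        by (intro dgr_inD(3)[OF CD])
      then show False
        using g(1)[OF ST(1)] g(1)[OF ST(2)] ne[OF ST(1)] ST(3) unfolding disjnt_def by blast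
    qed
    show "disjnt (g S) (g T)" if "S \<in> C" "T \<in> C" "disjnt S T" for S T
      using g(1)[OF that(1)] g(1)[OF that(2)] that(3) unfolding disjnt_def by blast
    fix S assume S: "S \<in> C"
    show "golomb_ruler (g S)"
      using dgr_inD(4)[OF CD S] g(1)[OF S] by (rule golomb_ruler_subset)
    show "g S \<subseteq> X"
      using g(1)[OF S] dgr_inD(5)[OF CD S] by (rule order_trans)
    show "card (g S) = J'"
      using S by (rule g(2))
  qed
  then show ?thesis by (rule that)
qed

section \<open>The least length \<open>H\<close>: attainment and monotonicity\<close>

lemma H_attained:
  assumes "0 < J"
  obtains D where "0 < H I J" "dgr_in I J {1..H I J} D"
proof -
  have "0 < H I J \<and> (\<exists>D. is_DGR I J (H I J) D)"
    \<comment> \<open>\<open>LEAST\<close> has the defining property only because some family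
      exists, which the powers of three provide.\<close>
    unfolding H_def by (rule LeastI_ex) (use DGR_exists[OF assms] in blast)
  then show ?thesis using that is_DGR_iff_dgr_in by blast
qed

lemma H_le: "dgr_in I J {1..n} D \<Longrightarrow> 0 < n \<Longrightarrow> H I J \<le> n"
  unfolding H_def by (rule Least_le) (auto simp: is_DGR_iff_dgr_in)

lemma H_mono:
  assumes "I' \<le> I" "0 < J'" "J' \<le> J"
  shows "H I' J' \<le> H I J"
proof -
  obtain D where "0 < H I J" "dgr_in I J {1..H I J} D"
    using assms by (meson H_attained less_le_trans)
  then show ?thesis
    using assms by (meson H_le dgr_in_restrict)
qed

section \<open>The two inequalities, with \<open>Suc J\<close> marks to avoid subtraction\<close>

lemma H_add_le:
  assumes "b \<le> a" "0 < J"
  shows "H (a + b) (Suc J) \<le> H a (Suc J) + H b J + b"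
proof -
  define n m where "n = H a (Suc J)" and "m = H b J"
  have mn: "m \<le> n"
    unfolding n_def m_def using assms by (intro H_mono) auto
  obtain A where A: "0 < n" "dgr_in a (Suc J) {1..n} A"
    using H_attained[of "Suc J" a] unfolding n_def by blast
  obtain B where B: "dgr_in b J {1..m} B"
    using H_attained[OF assms(2), of b] unfolding m_def by blast
  let ?E = "{m + n + 1..m + n + b}"
  \<comment> \<open>Marks of \<open>?E\<close> are at least \<open>n + 1\<close> away from
    \<open>{1..m}\<close>, whose diameter is at most \<open>m - 1\<close>; \<open>m \<le> n\<close>
    closes the comparison.\<close>
  have far: "\<bar>int s - int s'\<bar> < \<bar>int x - int t\<bar>"
    if "s \<in> {1..m}" "s' \<in> {1..m}" "t \<in> {1..m}" "x \<in> ?E" for s s' t x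
    using that mn unfolding atLeastAtMost_iff by linarith
  obtain B' where B': "dgr_in b (Suc J) ({1..m} \<union> ?E) B'"
    by (rule dgr_in_extend[OF B _ _ far, of ?E]) simp_all
  \<comment> \<open>Translation by \<open>m\<close> puts \<open>A\<close> exactly into the gap
    between \<open>{1..m}\<close> and \<open>?E\<close>.\<close>
  have "dgr_in (a + b) (Suc J) ({m + 1..m + n} \<union> ({1..m} \<union> ?E)) ((`) ((+) m) ` A \<union> B')"
    by (rule dgr_in_Un[OF dgr_in_shift[OF A(2)] B']) auto
  then have "dgr_in (a + b) (Suc J) {1..n + m + b} ((`) ((+) m) ` A \<union> B')"
    by (rule dgr_in_mono) auto
  then have "H (a + b) (Suc J) \<le> n + m + b"
    by (rule H_le) (use A(1) in simp)
  then show ?thesis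
    by (simp only: n_def m_def)
qed

lemma H_double_le:
  assumes "0 < J"
  shows "H (2 * a) (Suc J) \<le> 2 * H a J + 2 * a"
proof -
  define n where "n = H a J"
  obtain D where D: "0 < n" "dgr_in a J {1..n} D"
    using H_attained[OF assms, of a] unfolding n_def by blast
  \<comment> \<open>From left to right the blocks are \<open>?F\<close>, \<open>?X\<close>,
    \<open>?Y\<close>, \<open>?E\<close>. Pairing \<open>?X\<close> with \<open>?E\<close> and
    \<open>?Y\<close> with \<open>?F\<close> leaves a whole block of length \<open>n\<close> in
    between, so extra marks are at distance at least \<open>n + 1\<close>.\<close>
  let ?X = "{a + 1..a + n}" and ?Y = "{a + n + 1..a + n + n}"
  let ?E = "{a + n + n + 1..a + n + n + a}" and ?F = "{1..a}"
  have farE: "\<bar>int s - int s'\<bar> < \<bar>int x - int t\<bar>"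
    if "s \<in> ?X" "s' \<in> ?X" "t \<in> ?X" "x \<in> ?E" for s s' t x
    using that unfolding atLeastAtMost_iff by linarith
  have farF: "\<bar>int s - int s'\<bar> < \<bar>int x - int t\<bar>"
    if "s \<in> ?Y" "s' \<in> ?Y" "t \<in> ?Y" "x \<in> ?F" for s s' t x
    using that unfolding atLeastAtMost_iff by linarith
  obtain A where A: "dgr_in a (Suc J) (?X \<union> ?E) A"
    by (rule dgr_in_extend[OF dgr_in_shift[OF D(2), of a] _ _ farE, of ?E]) simp_all
  obtain B where B: "dgr_in a (Suc J) (?Y \<union> ?F) B"
    by (rule dgr_in_extend[OF dgr_in_shift[OF D(2), of "a + n"] _ _ farF, of ?F]) simp_all
  have "dgr_in (a + a) (Suc J) ((?X \<union> ?E) \<union> (?Y \<union> ?F)) (A \<union> B)"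
    by (rule dgr_in_Un[OF A B]) auto
  \<comment> \<open>The four blocks tile this interval.\<close>
  then have "dgr_in (a + a) (Suc J) {1..2 * n + 2 * a} (A \<union> B)"
    by (rule dgr_in_mono) auto
  then have "H (a + a) (Suc J) \<le> 2 * n + 2 * a"
    by (rule H_le) (use D(1) in simp)
  then show ?thesis
    by (simp only: n_def mult_2)
qed

theorem theorem4:
  fixes a b J :: nat
  assumes "0 < a" and "0 < b" and "3 \<le> J"
  shows "(a \<ge> b \<longrightarrow> H (a + b) J \<le> H a J + H b (J - 1) + b)
    \<and> (a \<ge> 2 \<longrightarrow> H (2 * a - 1) J \<le> H a J + H (a - 1) (J - 1) + (a - 1))
    \<and> H (2 * a) J \<le> 2 * H a (J - 1) + 2 * a"
proof -
  have J: "Suc (J - 1) = J" "0 < J - 1" and a: "a + (a - 1) = 2 * a - 1"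
    using assms by auto
  show ?thesis
    \<comment> \<open>The second claim is the first one with \<open>a - 1\<close> in place of
      \<open>b\<close>.\<close>
    using H_add_le[of b a "J - 1"] H_add_le[of "a - 1" a "J - 1"] H_double_le[of "J - 1" a]
    unfolding J(1) a using J(2) by linarith
qed

end
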